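(* Let $u=(1,2,\ldots,n)$ and let $m\in\{2,\ldots,n\}$ with $n-m\ge 4$. For any set $\{x_{j_1},\ldots,x_{j_m}\}$ of $m$ distinct variables in $\{x_{m+1},\ldots,x_n\}$, the inequality $$\sum_{i=1}^m x_{j_i}\ \ge\ \tfrac12 m(m+1)$$ is facet-defining for $H_n(u)$.
   Context: A point $x=(x_1,\ldots,x_n)\in\{1,\ldots,n\}^n$ is a circuit if the map $i\mapsto x_i$ is a permutation of $\{1,\ldots,n\}$ consisting of a single $n$-cycle. For $u=(1,\ldots,n)$, the hamiltonian circuit polytope $H_n(u)\subset\mathbb{R}^n$ is the convex hull of all circuits. An inequality is facet-defining for $H_n(u)$ if it is satisfied by all points of $H_n(u)$ and the set of points of $H_n(u)$ satisfying it at equality is a face of dimension $\dim H_n(u)-1$. *)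

theory Defs
  imports "HOL-Analysis.Analysis" "HOL-Combinatorics.Orbits"
begin

text \<open>
  The space of dimension \<open>n\<close> is \<^typ>\<open>real ^ 'n\<close> with \<open>n = CARD('n)\<close>. The coordinates are numbered by a
  bijection \<open>\<nu>\<close> from \<open>{1..n}\<close> to the index type, so that the paper's variable \<open>x\<^sub>j\<close>
  is \<open>x $ \<nu> j\<close>.
\<close>

definition circuit :: "(nat \<Rightarrow> 'n::finite) \<Rightarrow> real ^ 'n \<Rightarrow> bool" where
  "circuit \<nu> x \<longleftrightarrow>
     (\<exists>\<sigma>. \<sigma> permutes {1..CARD('n)} \<and> cyclic_on \<sigma> {1..CARD('n)} \<and>
          (\<forall>i\<in>{1..CARD('n)}. x $ \<nu> i = real (\<sigma> i)))"

definition hamiltonian_circuit_polytope :: "(nat \<Rightarrow> 'n::finite) \<Rightarrow> (real ^ 'n) set" where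
  "hamiltonian_circuit_polytope \<nu> = convex hull {x. circuit \<nu> x}"

text \<open>The inequality \<open>f x \<ge> b\<close>, for a linear form \<open>f\<close>, is facet-defining for \<open>P\<close>.\<close>

definition facet_defining_ge :: "('a::euclidean_space) set \<Rightarrow> ('a \<Rightarrow> real) \<Rightarrow> real \<Rightarrow> bool" where
  "facet_defining_ge P f b \<longleftrightarrow>
     (\<forall>x\<in>P. f x \<ge> b) \<and> {x \<in> P. f x = b} facet_of P"

end

theory Submission
  imports Defs "HOL-Combinatorics.Cycles"
begin

text \<open>
  Let \<open>M = {1..m}\<close> and \<open>E = {1..n} - J\<close>; as \<open>J\<close> lies above \<open>m\<close>, the set \<open>M\<close> is contained in \<open>E\<close>.
  A circuit takes \<open>m\<close> distinct positive values on \<open>J\<close>, so the inequality is valid, and it is tight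
  exactly when the underlying permutation maps \<open>J\<close> onto \<open>M\<close>.

  The polytope lies in the hyperplane on which all coordinates sum to \<open>n (n + 1) / 2\<close>, so its
  dimension is at most \<open>n - 1\<close>, and the face is proper because some circuit maps an element of
  \<open>J\<close> into \<open>J\<close>. It remains to see that the face has dimension at least \<open>n - 2\<close>. By
  orthogonality (\<open>aff_dim_ge_of_equations_in_span\<close>), this holds as soon as every linear
  equation satisfied by all tight circuits has coefficients that are constant on \<open>J\<close> and constant
  on \<open>E\<close> (\<open>equations_on_tight_circuits\<close>).

  To vary tight circuits freely, fix a bijection \<open>\<tau>\<close> from \<open>J\<close> to \<open>M\<close> and contract its arcs: the
  tight circuits that extend \<open>\<tau>\<close> correspond to the cyclic permutations of \<open>E\<close>
  (\<open>detour_cyclic\<close>), and the linear form becomes a tour cost \<open>c e e' = a e * h e'\<close> with an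
  injective \<open>h\<close>. Because \<open>E\<close> has \<open>n - m \<ge> 4\<close> elements, a tour cost that does not depend on the tour
  satisfies an exchange identity (\<open>exchange_of_constant_tour_cost\<close>), which here reads
  \<open>(a i - a j) * (h k - h l) = 0\<close> and makes \<open>a\<close> constant on \<open>E\<close>. The values outside \<open>J\<close> then contribute
  a constant, and swapping two values of \<open>\<tau>\<close> shows that \<open>a\<close> is constant on \<open>J\<close>.
\<close>

section \<open>Cyclic permutations and the cost of tours\<close>

lemma cyclic_on_cycle_of_list:
  assumes "distinct xs" "xs \<noteq> []"
  shows "cyclic_on (cycle_of_list xs) (set xs)"
proof -
  let ?f = "cycle_of_list xs"
  have nth: "(?f ^^ k) (hd xs) = xs ! k" if "k < length xs" for k
  proof -
    have "map (?f ^^ k) xs ! 0 = rotate k xs ! 0"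
      by (simp add: cyclic_rotation[OF assms(1)])
    then show ?thesis
      using that assms(2) by (simp add: nth_rotate hd_conv_nth)
  qed
  have perm: "?f permutes set xs"
    by (rule cycle_permutes)
  have "orbit ?f (hd xs) \<subseteq> set xs"
    using perm assms(2) by (intro permutes_orbit_subset) auto
  moreover have "y \<in> orbit ?f (hd xs)" if y: "y \<in> set xs" for y
  proof -
    obtain k where "k < length xs" "y = xs ! k"
      using y by (metis in_set_conv_nth)
    then have "y = (?f ^^ k) (hd xs)"
      by (simp add: nth)
    then show ?thesis
      by (auto simp: orbit_altdef_permutation[OF permutation_of_cycle])
  qed
  ultimately show ?thesis
    using assms(2) by (auto simp: cyclic_on_def intro!: bexI[of _ "hd xs"])
qed

fun walk_cost :: "('a \<Rightarrow> 'a \<Rightarrow> real) \<Rightarrow> 'a \<Rightarrow> 'a list \<Rightarrow> 'a \<Rightarrow> real" where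
  "walk_cost c x [] z = c x z"
| "walk_cost c x (y # ys) z = c x y + walk_cost c y ys z"

text \<open>Only the last arc of a walk sees the target.\<close>

lemma walk_cost_change_target:
  "walk_cost c x ys z - c (last (x # ys)) z = walk_cost c x ys z' - c (last (x # ys)) z'"
  by (induction ys arbitrary: x) auto

lemma sum_cycle_of_list:
  assumes "distinct (x # ys)"
  shows "(\<Sum>v\<in>set (x # ys). c v (cycle_of_list (x # ys) v)) = walk_cost c x ys x"
proof -
  let ?f = "cycle_of_list (x # ys)"
  have rot: "map ?f (x # ys) = ys @ [x]"
    using cyclic_rotation[OF assms, of 1] by simp
  have walk: "sum_list (map2 c (y # zs) (zs @ [z])) = walk_cost c y zs z" for y z zs
    by (induction zs arbitrary: y) auto
  have "(\<Sum>v\<in>set (x # ys). c v (?f v)) = sum_list (map (\<lambda>v. c v (?f v)) (x # ys))"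
    using assms by (rule sum_list_distinct_conv_sum_set[symmetric])
  also have "map (\<lambda>v. c v (?f v)) (x # ys) = map2 c (x # ys) (map ?f (x # ys))"
    by (simp add: zip_map2 zip_same_conv_map del: cycle_of_list.simps)
  finally show ?thesis
    unfolding rot walk .
qed

text \<open>
  A fixed path from \<open>l\<close> through all the remaining vertices to some \<open>q\<close> acts as a single vertex, entered
  at \<open>l\<close> and left at \<open>q\<close>, so only four vertices matter. On them there are six tours, and with
  coefficients \<open>1/2\<close> and \<open>- 1/2\<close> they combine to the identity; each arc out of \<open>q\<close> cancels, so the path
  leaves no trace. In other words, a matrix with constant tour cost has the form \<open>\<alpha> i + \<beta> j\<close> off the
  diagonal.
\<close>

lemma exchange_of_constant_tour_cost:
  fixes c :: "'a \<Rightarrow> 'a \<Rightarrow> real"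
  assumes "finite V" and V: "{i, j, k, l} \<subseteq> V" and dist: "distinct [i, j, k, l]"
    and const: "\<And>\<rho>. \<rho> permutes V \<Longrightarrow> cyclic_on \<rho> V \<Longrightarrow> (\<Sum>v\<in>V. c v (\<rho> v)) = K"
  shows "c i k + c j l = c i l + c j k"
proof -
  obtain rest where rest: "set rest = V - {i, j, k, l}" "distinct rest"
    using finite_distinct_list[of "V - {i, j, k, l}"] \<open>finite V\<close> by auto
  define q where "q = last (l # rest)"
  define W where "W = walk_cost c l rest i - c q i"
  have W: "walk_cost c l rest z = W + c q z" for z
    using walk_cost_change_target[of c l rest z i] by (simp add: W_def q_def)
  have tour: "c x y + c y z + c z l + W + c q x = K"
    if "distinct [x, y, z]" "{x, y, z} = {i, j, k}" for x y z
  proof -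
    let ?ys = "y # z # l # rest"
    have "x \<in> {i, j, k}" "y \<in> {i, j, k}" "z \<in> {i, j, k}"
      unfolding that(2)[symmetric] by simp_all
    then have d: "distinct (x # ?ys)"
      using that(1) dist rest by auto
    have "set (x # ?ys) = {x, y, z} \<union> insert l (set rest)"
      by auto
    then have s: "set (x # ?ys) = V"
      unfolding that(2) using V rest(1) by auto
    have "(\<Sum>v\<in>V. c v (cycle_of_list (x # ?ys) v)) = K"
    proof (rule const)
      show "cycle_of_list (x # ?ys) permutes V"
        using cycle_permutes[of "x # ?ys"] unfolding s .
      show "cyclic_on (cycle_of_list (x # ?ys)) V"
        using cyclic_on_cycle_of_list[OF d] unfolding s by blast
    qed
    then have "walk_cost c x ?ys x = K"
      using sum_cycle_of_list[OF d, of c] unfolding s by metis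
    then show ?thesis
      by (simp add: W)
  qed
  \<comment> \<open>Half the sum of the first three minus half the sum of the last three gives the claim.\<close>
  have "c i k + c k j + c j l + W + c q i = K" "c k i + c i j + c j l + W + c q k = K"
    "c j i + c i k + c k l + W + c q j = K" "c j k + c k i + c i l + W + c q j = K"
    "c i j + c j k + c k l + W + c q i = K" "c k j + c j i + c i l + W + c q k = K"
    using dist by (intro tour; auto)+
  then show ?thesis
    by linarith
qed

section \<open>Tours through prescribed arcs\<close>

text \<open>
  Inverse of contracting the arcs \<open>j \<rightarrow> \<tau> j\<close>: an arc of \<open>\<rho>\<close> into \<open>\<tau> j\<close> is replaced by a path
  through \<open>j\<close>.
\<close>

definition detour :: "'a set \<Rightarrow> ('a \<Rightarrow> 'a) \<Rightarrow> ('a \<Rightarrow> 'a) \<Rightarrow> 'a \<Rightarrow> 'a" where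
  "detour J \<tau> \<rho> x = (if x \<in> J then \<tau> x
     else if \<rho> x \<in> \<tau> ` J then inv_into J \<tau> (\<rho> x) else \<rho> x)"

text \<open>
  Following \<open>\<rho>\<close> by one step amounts to following the detour by one or two steps, so the detour's
  orbit contains the orbit of \<open>\<rho>\<close>, which is \<open>E\<close>, and it passes through \<open>j \<in> J\<close> on its way to \<open>\<tau> j\<close>.
\<close>

lemma detour_cyclic:
  assumes fin: "finite (J \<union> E)" and disj: "J \<inter> E = {}"
    and inj: "inj_on \<tau> J" and img: "\<tau> ` J \<subseteq> E"
    and perm: "\<rho> permutes E" and cyc: "cyclic_on \<rho> E"
  shows "detour J \<tau> \<rho> permutes J \<union> E" "cyclic_on (detour J \<tau> \<rho>) (J \<union> E)"
proof -
  let ?s = "detour J \<tau> \<rho>"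
  have rho_E: "\<rho> x \<in> E \<longleftrightarrow> x \<in> E" for x
    using permutes_in_image[OF perm] .
  have onJ: "?s x = \<tau> x" if "x \<in> J" for x
    using that by (simp add: detour_def)
  have E_J: "x \<notin> J" if "x \<in> E" for x
    using that disj by auto
  have into: "?s x \<in> J \<union> E" if "x \<in> J \<union> E" for x
    using that img rho_E[of x] inv_into_into[of "\<rho> x" \<tau> J] by (auto simp: detour_def)
  have enter: "?s e = j" if "j \<in> J" "\<rho> e = \<tau> j" for e j
  proof -
    have "e \<in> E" using that img rho_E[of e] by auto
    then show ?thesis
      using that inj E_J by (auto simp: detour_def)
  qed
  have plain: "?s e = \<rho> e" if "e \<in> E" "\<rho> e \<notin> \<tau> ` J" for e
    using that E_J by (auto simp: detour_def)
  have pre: "\<exists>e\<in>E. \<rho> e = y" if "y \<in> E" for y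
    using that permutes_image[OF perm] by (metis imageE)
  have "y \<in> ?s ` (J \<union> E)" if y: "y \<in> J \<union> E" for y
  proof -
    consider "y \<in> J" | "y \<in> \<tau> ` J" | "y \<in> E" "y \<notin> \<tau> ` J"
      using y by auto
    then show ?thesis
    proof cases
      case 1
      then obtain e where "e \<in> E" "\<rho> e = \<tau> y" using pre[of "\<tau> y"] img by auto
      then show ?thesis using enter[OF 1] by force
    next
      case 2
      then show ?thesis using onJ by force
    next
      case 3
      then obtain e where "e \<in> E" "\<rho> e = y" using pre by auto
      then show ?thesis using plain 3 by force
    qed
  qed
  then have surj: "?s ` (J \<union> E) = J \<union> E"
    using into by auto
  then have "bij_betw ?s (J \<union> E) (J \<union> E)"
    using finite_surj_inj[OF fin] by (auto simp: bij_betw_def)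
  moreover have "?s x = x" if "x \<notin> J \<union> E" for x
    using that img permutes_not_in[OF perm, of x] by (auto simp: detour_def)
  ultimately show perm': "?s permutes J \<union> E"
    by (rule bij_imp_permutes)

  obtain s where s: "s \<in> E" "E = orbit \<rho> s"
    using cyc by (auto simp: cyclic_on_def)
  have self: "s \<in> orbit ?s s"
    using perm' fin by (intro permutation_self_in_orbit) (auto simp: permutation_permutes)
  have advance: "\<rho> y \<in> orbit ?s s" if y: "y \<in> orbit ?s s" "y \<in> E" for y
  proof (cases "\<rho> y \<in> \<tau> ` J")
    case True
    then obtain j where j: "j \<in> J" "\<rho> y = \<tau> j" by auto
    then have "\<rho> y = ?s (?s y)" using enter onJ by simp
    then show ?thesis using y by (auto intro: orbit.step)
  next
    case False
    then show ?thesis using y plain orbit.step[of y ?s s] by simp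
  qed
  have E_orb: "y \<in> orbit ?s s" if "y \<in> E" for y
  proof -
    have "y \<in> orbit \<rho> s" using that s by simp
    then show ?thesis
    proof induction
      case base
      then show ?case using advance self s by simp
    next
      case (step y)
      then show ?case using advance s(2) by simp
    qed
  qed
  have J_orb: "y \<in> orbit ?s s" if y: "y \<in> J" for y
  proof -
    obtain e where "e \<in> E" "\<rho> e = \<tau> y" using pre[of "\<tau> y"] img y by auto
    then show ?thesis using enter[OF y] E_orb orbit.step[of e ?s s] by auto
  qed
  have "orbit ?s s \<subseteq> J \<union> E"
    using perm' s by (intro permutes_orbit_subset) auto
  then have "J \<union> E = orbit ?s s"
    using E_orb J_orb by auto
  then show "cyclic_on ?s (J \<union> E)"
    using s(1) by (auto simp: cyclic_on_def)
qed

section \<open>Equations valid on the tight circuits\<close>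

text \<open>
  The assumption \<open>m + 4 \<le> n\<close> provides the four elements of \<open>{1..n} - J\<close> that the exchange identity
  needs. On \<open>J\<close>, two values can be swapped directly, since every bijection from \<open>J\<close> to \<open>{1..m}\<close>
  extends to a tight circuit.
\<close>

lemma equations_on_tight_circuits:
  fixes a :: "nat \<Rightarrow> real"
  assumes J: "J \<subseteq> {m+1..n}" "card J = m" and "m + 4 \<le> n"
    and const: "\<And>\<sigma>. \<sigma> permutes {1..n} \<Longrightarrow> cyclic_on \<sigma> {1..n} \<Longrightarrow> \<sigma> ` J = {1..m} \<Longrightarrow>
      (\<Sum>i=1..n. a i * real (\<sigma> i)) = K"
  shows "i \<in> {1..n} - J \<Longrightarrow> j \<in> {1..n} - J \<Longrightarrow> a i = a j"
    and "i \<in> J \<Longrightarrow> j \<in> J \<Longrightarrow> a i = a j"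
proof -
  define E where "E = {1..n} - J"
  have finJ: "finite J" and finE: "finite E" and disj: "J \<inter> E = {}" and un: "J \<union> E = {1..n}"
    using J finite_subset by (auto simp: E_def)
  have ME: "{1..m} \<subseteq> E"
    using J \<open>m + 4 \<le> n\<close> by (auto simp: E_def)
  have cardE: "card E \<ge> 4"
    using J \<open>m + 4 \<le> n\<close> finJ unfolding E_def by (subst card_Diff_subset) auto
  obtain \<tau>0 where \<tau>0: "bij_betw \<tau>0 J {1..m}"
    using finite_same_card_bij[of J "{1..m}"] J finJ by auto

  \<comment> \<open>Where the detour goes from the \<open>\<rho>\<close>-predecessor of \<open>e\<close>.\<close>
  define h where "h \<tau> e = (if e \<in> {1..m} then inv_into J \<tau> e else e)" for \<tau> and e :: nat
  have split: "(\<Sum>j\<in>J. a j * real (\<tau> j)) + (\<Sum>e\<in>E. a e * real (h \<tau> (\<rho> e))) = K"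
    if \<tau>: "bij_betw \<tau> J {1..m}" and \<rho>: "\<rho> permutes E" "cyclic_on \<rho> E" for \<tau> \<rho>
  proof -
    have im: "\<tau> ` J = {1..m}" "inj_on \<tau> J"
      using \<tau> by (auto simp: bij_betw_def)
    note cyc = detour_cyclic[of J E \<tau> \<rho>, unfolded un, OF _ disj im(2) _ \<rho>]
    have "(\<Sum>i=1..n. a i * real (detour J \<tau> \<rho> i)) = K"
      using ME im by (intro const cyc) (auto simp: detour_def)
    moreover have "(\<Sum>i=1..n. a i * real (detour J \<tau> \<rho> i))
      = (\<Sum>j\<in>J. a j * real (detour J \<tau> \<rho> j)) + (\<Sum>e\<in>E. a e * real (detour J \<tau> \<rho> e))"
      unfolding un[symmetric] using finJ finE disj by (intro sum.union_disjoint)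
    moreover have "(\<Sum>e\<in>E. a e * real (detour J \<tau> \<rho> e)) = (\<Sum>e\<in>E. a e * real (h \<tau> (\<rho> e)))"
      using disj by (intro sum.cong) (auto simp: detour_def h_def im)
    moreover have "(\<Sum>j\<in>J. a j * real (detour J \<tau> \<rho> j)) = (\<Sum>j\<in>J. a j * real (\<tau> j))"
      by (intro sum.cong) (auto simp: detour_def)
    ultimately show ?thesis by simp
  qed
  have inj_h: "inj_on (h \<tau>0) E"
  proof -
    have "bij_betw (h \<tau>0) {1..m} J"
      using bij_betw_inv_into[OF \<tau>0] by (rule bij_betw_cong[THEN iffD1, rotated]) (simp add: h_def)
    moreover have "bij_betw (h \<tau>0) (E - {1..m}) (E - {1..m})"
      using bij_betw_id[of "E - {1..m}"] by (rule bij_betw_cong[THEN iffD1, rotated]) (auto simp: h_def)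
    moreover have "J \<inter> (E - {1..m}) = {}"
      using disj by auto
    ultimately have "bij_betw (h \<tau>0) ({1..m} \<union> (E - {1..m})) (J \<union> (E - {1..m}))"
      by (rule bij_betw_combine)
    then show ?thesis
      using ME by (simp add: bij_betw_def Un_absorb1)
  qed

  have constE: "a i = a j" if ij: "i \<in> E" "j \<in> E" for i j
  proof (cases "i = j")
    case False
    have "card (E - {i, j}) \<ge> 2"
      using ij False cardE finE by simp
    then obtain k l where kl: "k \<in> E - {i, j}" "l \<in> E - {i, j}" "k \<noteq> l"
      by (metis One_nat_def Suc_1 card_le_Suc0_iff_eq card.infinite not_less_eq_eq zero_le)
    have "a i * real (h \<tau>0 k) + a j * real (h \<tau>0 l) = a i * real (h \<tau>0 l) + a j * real (h \<tau>0 k)"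
      using ij kl False finE split[OF \<tau>0]
      by (intro exchange_of_constant_tour_cost[where V = E
            and K = "K - (\<Sum>j\<in>J. a j * real (\<tau>0 j))"]) (auto simp: algebra_simps)
    then have "(a i - a j) * (real (h \<tau>0 k) - real (h \<tau>0 l)) = 0"
      by (simp add: algebra_simps)
    moreover have "h \<tau>0 k \<noteq> h \<tau>0 l"
      using inj_h kl by (auto dest: inj_onD)
    ultimately show ?thesis by simp
  qed simp
  show "i \<in> {1..n} - J \<Longrightarrow> j \<in> {1..n} - J \<Longrightarrow> a i = a j"
    unfolding E_def[symmetric] by (rule constE)

  \<comment> \<open>With \<open>a\<close> constant on \<open>E\<close>, the part of the sum over \<open>E\<close> does not depend on \<open>\<tau>\<close>.\<close>
  obtain es where es: "set es = E" "distinct es"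
    using finite_distinct_list[OF finE] by auto
  have "es \<noteq> []" using es cardE by auto
  define \<rho> where "\<rho> = cycle_of_list es"
  have \<rho>: "\<rho> permutes E" "cyclic_on \<rho> E"
    using cycle_permutes[of es] cyclic_on_cycle_of_list[of es] es \<open>es \<noteq> []\<close>
    by (auto simp: \<rho>_def)
  obtain e0 where e0: "e0 \<in> E"
    using es \<open>es \<noteq> []\<close> by (metis hd_in_set)
  have outside: "(\<Sum>e\<in>E. a e * real (h \<tau> (\<rho> e)))
      = a e0 * (real (\<Sum>J) + real (\<Sum>(E - {1..m})))" if \<tau>: "bij_betw \<tau> J {1..m}" for \<tau>
  proof -
    have inv: "bij_betw (inv_into J \<tau>) {1..m} J"
      using \<tau> by (rule bij_betw_inv_into)
    have "(\<Sum>e\<in>E. a e * real (h \<tau> (\<rho> e))) = (\<Sum>e\<in>E. a e0 * real (h \<tau> (\<rho> e)))"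
      using constE[OF _ e0] by (intro sum.cong) auto
    also have "\<dots> = a e0 * (\<Sum>e\<in>E. real (h \<tau> (\<rho> e)))"
      by (simp add: sum_distrib_left)
    also have "(\<Sum>e\<in>E. real (h \<tau> (\<rho> e))) = (\<Sum>e\<in>E. real (h \<tau> e))"
      using sum.permute[OF \<rho>(1), of "\<lambda>e. real (h \<tau> e)"] by (simp add: o_def)
    also have "\<dots> = (\<Sum>e\<in>E - {1..m}. real (h \<tau> e)) + (\<Sum>e\<in>{1..m}. real (h \<tau> e))"
      using sum.subset_diff[OF ME finE] .
    also have "(\<Sum>e\<in>E - {1..m}. real (h \<tau> e)) = (\<Sum>e\<in>E - {1..m}. real e)"
      by (intro sum.cong) (auto simp: h_def)
    also have "(\<Sum>e\<in>{1..m}. real (h \<tau> e)) = (\<Sum>e\<in>{1..m}. real (inv_into J \<tau> e))"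
      by (intro sum.cong) (simp_all add: h_def)
    also have "\<dots> = (\<Sum>j\<in>J. real j)"
      by (rule sum.reindex_bij_betw[OF inv])
    finally show ?thesis by simp
  qed
  have constJ: "a i = a j" if ij: "i \<in> J" "j \<in> J" for i j
  proof (cases "i = j")
    case False
    define \<tau> where "\<tau> = \<tau>0 \<circ> Transposition.transpose i j"
    have "bij_betw (Transposition.transpose i j) J J"
      using ij by (intro permutes_imp_bij permutes_swap_id)
    then have \<tau>: "bij_betw \<tau> J {1..m}"
      unfolding \<tau>_def using \<tau>0 by (rule bij_betw_trans)
    have "(\<Sum>v\<in>J. a v * real (\<tau> v)) = (\<Sum>v\<in>J. a v * real (\<tau>0 v))"
      using split[OF \<tau> \<rho>] split[OF \<tau>0 \<rho>] outside[OF \<tau>] outside[OF \<tau>0] by linarith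
    moreover have "(\<Sum>v\<in>J. f v) = f i + f j + (\<Sum>v\<in>J - {i, j}. f v)" for f :: "nat \<Rightarrow> real"
      using sum.subset_diff[of "{i, j}" J f] ij False finJ by simp
    moreover have "(\<Sum>v\<in>J - {i, j}. a v * real (\<tau> v)) = (\<Sum>v\<in>J - {i, j}. a v * real (\<tau>0 v))"
      by (intro sum.cong) (auto simp: \<tau>_def)
    ultimately have "a i * real (\<tau>0 j) + a j * real (\<tau>0 i) = a i * real (\<tau>0 i) + a j * real (\<tau>0 j)"
      by (simp add: \<tau>_def)
    then have "(a i - a j) * (real (\<tau>0 j) - real (\<tau>0 i)) = 0"
      by (simp add: algebra_simps)
    moreover have "\<tau>0 i \<noteq> \<tau>0 j"
      using \<tau>0 ij False by (auto simp: bij_betw_def dest: inj_onD)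
    ultimately show ?thesis by simp
  qed simp
  show "i \<in> J \<Longrightarrow> j \<in> J \<Longrightarrow> a i = a j"
    by (rule constJ)
qed

section \<open>Validity and dimension\<close>

text \<open>
  Exchanging the elements of \<open>A\<close> above \<open>m\<close> for the missing elements of \<open>{1..m}\<close>, of which there are
  equally many, lowers the sum by at least one each time. The extra term serves to exhibit a
  circuit at which the inequality is strict.
\<close>

lemma sum_positive_nats_ge:
  fixes A :: "nat set"
  assumes "finite A" "0 \<notin> A" "card A = m"
  shows "\<Sum>{1..m} + card (A - {1..m}) \<le> \<Sum>A"
proof -
  have card: "card (A - {1..m}) = card ({1..m} - A)"
    using assms(1,3) by (simp add: card_Diff_subset_Int Int_commute)
  have "\<Sum>({1..m} - A) \<le> card ({1..m} - A) * m"
    using sum_bounded_above[of "{1..m} - A" "\<lambda>x. x" m] by simp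
  moreover have "card (A - {1..m}) * (m + 1) \<le> \<Sum>(A - {1..m})"
    using assms(2) sum_bounded_below[of "A - {1..m}" "m + 1" "\<lambda>x. x"]
    by (force simp: Suc_le_eq not_le)
  moreover have "\<Sum>A = \<Sum>(A - {1..m}) + \<Sum>(A \<inter> {1..m})"
    using assms(1) by (metis Int_Diff_Un add.commute sum.Int_Diff)
  moreover have "\<Sum>{1..m} = \<Sum>({1..m} - A) + \<Sum>(A \<inter> {1..m})"
    by (metis Int_commute add.commute finite_atLeastAtMost sum.Int_Diff)
  ultimately show ?thesis
    using card by (simp add: algebra_simps)
qed

text \<open>
  The normal vectors of the equations valid on \<open>F\<close> form the orthogonal complement of the
  direction space of \<open>F\<close>.
\<close>

lemma aff_dim_ge_of_equations_in_span:
  fixes F :: "'a::euclidean_space set"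
  assumes "x0 \<in> F" "finite W"
    and eqs: "\<And>a. (\<And>x. x \<in> F \<Longrightarrow> a \<bullet> x = a \<bullet> x0) \<Longrightarrow> a \<in> span W"
  shows "int DIM('a) - int (card W) \<le> aff_dim F"
proof -
  define D where "D = (\<lambda>x. x - x0) ` F"
  define N where "N = {y \<in> UNIV. \<forall>x \<in> span D. orthogonal x y}"
  have "dim N + dim (span D) = DIM('a)"
    unfolding N_def by (subst dim_subspace_orthogonal_to_vectors) auto
  moreover have "N \<subseteq> span W"
  proof
    fix a assume a: "a \<in> N"
    have "a \<bullet> x = a \<bullet> x0" if "x \<in> F" for x
    proof -
      have "x - x0 \<in> span D" using that by (auto simp: D_def intro: span_base)
      then have "(x - x0) \<bullet> a = 0"
        using a by (simp add: N_def orthogonal_def)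
      then have "a \<bullet> (x - x0) = 0"
        by (metis inner_commute)
      then show ?thesis by (simp add: inner_diff_right)
    qed
    then show "a \<in> span W" by (rule eqs)
  qed
  then have "dim N \<le> card W"
    using \<open>finite W\<close> by (meson dim_le_card)
  moreover have "aff_dim F = int (dim D)"
    unfolding D_def using \<open>x0 \<in> F\<close> by (intro aff_dim_eq_dim_subtract hull_inc)
  ultimately show ?thesis by simp
qed

theorem corollary13:
  fixes \<nu> :: "nat \<Rightarrow> 'n::finite" and n m :: nat and J :: "nat set"
  assumes "n = CARD('n)"
    and "bij_betw \<nu> {1..n} (UNIV :: 'n set)"
    and "m \<in> {2..n}" and "int n - int m \<ge> 4"
    and "J \<subseteq> {m+1..n}" and "card J = m"
  shows "facet_defining_ge (hamiltonian_circuit_polytope \<nu>)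
           (\<lambda>x :: real ^ 'n. \<Sum>j\<in>J. x $ \<nu> j) (1 / 2 * real m * (real m + 1))"
proof -
  note n = assms(1) and \<nu> = assms(2) and J = assms(5,6)
  have mn: "m + 4 \<le> n" and m2: "2 \<le> m"
    using assms(3,4) by auto
  have finJ: "finite J" and J_sub: "J \<subseteq> {1..n}"
    using J finite_subset by auto
  have inj: "inj_on \<nu> {1..n}"
    using \<nu> by (simp add: bij_betw_def)
  let ?P = "hamiltonian_circuit_polytope \<nu>"
  let ?b = "1 / 2 * real m * (real m + 1)"
  define w :: "real ^ 'n" where "w = (\<chi> i. if i \<in> \<nu> ` J then 1 else 0)"
  define u :: "real ^ 'n" where "u = (\<chi> i. 1)"
  have inner: "a \<bullet> x = (\<Sum>k=1..n. a $ \<nu> k * x $ \<nu> k)" for a x :: "real ^ 'n"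
    unfolding inner_vec_def inner_real_def
    by (rule sum.reindex_bij_betw[OF \<nu>, symmetric])
  have w_nth: "w $ \<nu> k = (if k \<in> J then 1 else 0)" if "k \<in> {1..n}" for k
    using inj_on_image_mem_iff[OF inj that J_sub] by (simp add: w_def)
  have w: "w \<bullet> x = (\<Sum>j\<in>J. x $ \<nu> j)" for x
  proof -
    have "w \<bullet> x = (\<Sum>k=1..n. if k \<in> J then x $ \<nu> k else 0)"
      unfolding inner by (intro sum.cong) (auto simp: w_nth)
    also have "\<dots> = (\<Sum>k\<in>{1..n} \<inter> J. x $ \<nu> k)"
      by (simp add: sum.inter_restrict)
    also have "{1..n} \<inter> J = J"
      using J_sub by auto
    finally show ?thesis .
  qed
  have b: "?b = real (\<Sum>{1..m})"
    by (induction m) (simp_all add: field_simps)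

  have ex_circuit: "\<exists>x. circuit \<nu> x \<and> (\<forall>k\<in>{1..n}. x $ \<nu> k = real (\<sigma> k))"
    if "\<sigma> permutes {1..n}" "cyclic_on \<sigma> {1..n}" for \<sigma>
  proof -
    have "(\<chi> i. real (\<sigma> (inv_into {1..n} \<nu> i))) $ \<nu> k = real (\<sigma> k)" if "k \<in> {1..n}" for k
      using that inj by simp
    then show ?thesis
      using that unfolding circuit_def n[symmetric] by blast
  qed
  have sums: "w \<bullet> x = real (\<Sum>(\<sigma> ` J))"
    if "\<sigma> permutes {1..n}" "\<forall>k\<in>{1..n}. x $ \<nu> k = real (\<sigma> k)" for \<sigma> x
  proof -
    have "inj_on \<sigma> J"
      using that(1) permutes_inj_on by blast
    then have "real (\<Sum>(\<sigma> ` J)) = (\<Sum>j\<in>J. real (\<sigma> j))"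
      by (simp add: sum.reindex)
    also have "\<dots> = w \<bullet> x"
      unfolding w using that(2) J_sub by (intro sum.cong) auto
    finally show ?thesis by simp
  qed
  have lower: "\<Sum>{1..m} + card (\<sigma> ` J - {1..m}) \<le> \<Sum>(\<sigma> ` J)"
    if "\<sigma> permutes {1..n}" for \<sigma>
  proof (rule sum_positive_nats_ge)
    have "\<sigma> ` J \<subseteq> {1..n}"
      using J_sub permutes_image[OF that] by blast
    then show "0 \<notin> \<sigma> ` J" by auto
    show "card (\<sigma> ` J) = m"
      using J(2) permutes_inj_on[OF that, of J] by (simp add: card_image)
  qed (use finJ in simp)

  have circuit_ge: "?b \<le> w \<bullet> x" and circuit_sum: "u \<bullet> x = real (\<Sum>{1..n})"
    if x: "circuit \<nu> x" for x
  proof -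
    obtain \<sigma> where \<sigma>: "\<sigma> permutes {1..n}" "\<forall>k\<in>{1..n}. x $ \<nu> k = real (\<sigma> k)"
      using x unfolding circuit_def n[symmetric] by auto
    show "?b \<le> w \<bullet> x"
      unfolding b sums[OF \<sigma>] using lower[OF \<sigma>(1)] by linarith
    have "u \<bullet> x = (\<Sum>k=1..n. real (\<sigma> k))"
      unfolding inner u_def using \<sigma>(2) by (intro sum.cong) auto
    also have "\<dots> = (\<Sum>k=1..n. real k)"
      using sum.permute[OF \<sigma>(1), of real] by (simp add: o_def)
    finally show "u \<bullet> x = real (\<Sum>{1..n})" by simp
  qed
  have convP: "convex ?P"
    by (simp add: hamiltonian_circuit_polytope_def convex_convex_hull)
  have inP: "x \<in> ?P" if "circuit \<nu> x" for x
    unfolding hamiltonian_circuit_polytope_def using that by (intro hull_inc) simp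
  have valid: "?b \<le> w \<bullet> x" if "x \<in> ?P" for x
  proof -
    have "?P \<subseteq> {x. w \<bullet> x \<ge> ?b}"
      unfolding hamiltonian_circuit_polytope_def using circuit_ge
      by (intro hull_minimal convex_halfspace_ge) auto
    then show ?thesis using that by auto
  qed

  define F where "F = {x \<in> ?P. w \<bullet> x = ?b}"
  have face: "F face_of ?P"
    using face_of_Int_supporting_hyperplane_ge[OF convP valid] by (simp add: F_def Int_def)
  have ex_tight: "\<exists>x\<in>F. \<forall>k\<in>{1..n}. x $ \<nu> k = real (\<sigma> k)"
    if \<sigma>: "\<sigma> permutes {1..n}" "cyclic_on \<sigma> {1..n}" "\<sigma> ` J = {1..m}" for \<sigma>
  proof -
    obtain x where x: "circuit \<nu> x" "\<forall>k\<in>{1..n}. x $ \<nu> k = real (\<sigma> k)"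
      using ex_circuit[OF \<sigma>(1,2)] by auto
    have "w \<bullet> x = ?b"
      unfolding b using sums[OF \<sigma>(1) x(2)] \<sigma>(3) by simp
    then show ?thesis
      using x inP by (auto simp: F_def)
  qed

  \<comment> \<open>A circuit with an arc inside \<open>J\<close> takes a value above \<open>m\<close> on \<open>J\<close> and is therefore not tight.\<close>
  obtain j j' where jj': "j \<in> J" "j' \<in> J" "j \<noteq> j'"
    using m2 J(2) finJ by (metis One_nat_def Suc_1 card_le_Suc0_iff_eq not_less_eq_eq)
  obtain rest where rest: "set rest = {1..n} - {j, j'}" "distinct rest"
    using finite_distinct_list[of "{1..n} - {j, j'}"] by auto
  define xs where "xs = j # j' # rest"
  have xs: "set xs = {1..n}" "distinct xs" "xs \<noteq> []"
    using rest jj' J_sub by (auto simp: xs_def)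
  have perm_xs: "cycle_of_list xs permutes {1..n}" "cyclic_on (cycle_of_list xs) {1..n}"
    using cycle_permutes[of xs] cyclic_on_cycle_of_list[OF xs(2,3)] xs(1) by auto
  have "cycle_of_list xs j = j'"
    using cyclic_rotation[OF xs(2), of 1] by (simp add: xs_def)
  then have "j' \<in> cycle_of_list xs ` J - {1..m}"
    using jj' J(1) by force
  then have "card (cycle_of_list xs ` J - {1..m}) > 0"
    using finJ by (auto simp: card_gt_0_iff)
  then have strict: "\<Sum>{1..m} < \<Sum>(cycle_of_list xs ` J)"
    using lower[OF perm_xs(1)] by linarith
  obtain y where y: "circuit \<nu> y" "\<forall>k\<in>{1..n}. y $ \<nu> k = real (cycle_of_list xs k)"
    using ex_circuit[OF perm_xs] by auto
  have "?b < w \<bullet> y"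
    unfolding b sums[OF perm_xs(1) y(2)] using strict by (rule of_nat_less_iff[THEN iffD2])
  then have "F \<noteq> ?P"
    using inP[OF y(1)] by (force simp: F_def)
  then have "aff_dim F < aff_dim ?P"
    using face_of_aff_dim_lt[OF convP face] by simp

  have "?P \<subseteq> {x. u \<bullet> x = real (\<Sum>{1..n})}"
    unfolding hamiltonian_circuit_polytope_def using circuit_sum
    by (intro hull_minimal convex_hyperplane) auto
  then have "aff_dim ?P \<le> aff_dim {x. u \<bullet> x = real (\<Sum>{1..n})}"
    by (rule aff_dim_subset)
  also have "\<dots> = int n - 1"
    by (subst aff_dim_hyperplane) (auto simp: u_def vec_eq_iff n)
  finally have dimP: "aff_dim ?P \<le> int n - 1" .

  \<comment> \<open>Without tight circuits every equation would hold on them vacuously, even one whose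
    coefficients are pairwise distinct.\<close>
  have "F \<noteq> {}"
  proof
    assume "F = {}"
    have "1 \<in> {1..n} - J" "2 \<in> {1..n} - J"
      using J(1) mn m2 by auto
    moreover have "(\<Sum>i=1..n. real i * real (\<sigma> i)) = 0"
      if "\<sigma> permutes {1..n}" "cyclic_on \<sigma> {1..n}" "\<sigma> ` J = {1..m}" for \<sigma>
      using ex_tight[OF that] \<open>F = {}\<close> by blast
    ultimately have "real 1 = real 2"
      by (rule equations_on_tight_circuits(1)[OF J mn, rotated])
    then show False by simp
  qed
  then obtain x0 where x0: "x0 \<in> F" by auto
  have span: "a \<in> span {u, w}" if a: "\<And>x. x \<in> F \<Longrightarrow> a \<bullet> x = a \<bullet> x0" for a
  proof -
    have const: "(\<Sum>k=1..n. a $ \<nu> k * real (\<sigma> k)) = a \<bullet> x0"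
      if \<sigma>: "\<sigma> permutes {1..n}" "cyclic_on \<sigma> {1..n}" "\<sigma> ` J = {1..m}" for \<sigma>
    proof -
      obtain x where x: "x \<in> F" "\<forall>k\<in>{1..n}. x $ \<nu> k = real (\<sigma> k)"
        using ex_tight[OF \<sigma>] by auto
      have "(\<Sum>k=1..n. a $ \<nu> k * real (\<sigma> k)) = a \<bullet> x"
        unfolding inner using x(2) by (intro sum.cong) auto
      then show ?thesis using a[OF x(1)] by simp
    qed
    have one: "1 \<in> {1..n} - J" using J(1) mn m2 by auto
    have eqE: "a $ \<nu> k = a $ \<nu> 1" if "k \<in> {1..n} - J" for k
      using const that one by (rule equations_on_tight_circuits(1)[OF J mn])
    have eqJ: "a $ \<nu> k = a $ \<nu> j" if "k \<in> J" for k
      using const that jj'(1) by (rule equations_on_tight_circuits(2)[OF J mn])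
    have "a $ \<nu> k = (a $ \<nu> 1 *\<^sub>R u + (a $ \<nu> j - a $ \<nu> 1) *\<^sub>R w) $ \<nu> k" if "k \<in> {1..n}" for k
    proof (cases "k \<in> J")
      case True
      then show ?thesis
        using eqJ[OF True] w_nth[OF that] by (simp add: u_def)
    next
      case False
      then show ?thesis
        using eqE[of k] that w_nth[OF that] by (simp add: u_def)
    qed
    moreover have "\<exists>k\<in>{1..n}. i = \<nu> k" for i
      using \<nu> by (metis UNIV_I bij_betw_imp_surj_on imageE)
    ultimately have "a = a $ \<nu> 1 *\<^sub>R u + (a $ \<nu> j - a $ \<nu> 1) *\<^sub>R w"
      unfolding vec_eq_iff by metis
    then show ?thesis
      by (metis insertCI span_add span_base span_scale)
  qed
  have "card {u, w} \<le> 2"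
    by (simp add: card_insert_if)
  then have "int n - 2 \<le> aff_dim F"
    using aff_dim_ge_of_equations_in_span[OF x0 _ span] by (simp add: n)
  then have "aff_dim F = aff_dim ?P - 1"
    using dimP \<open>aff_dim F < aff_dim ?P\<close> by linarith
  then have "F facet_of ?P"
    using face x0 by (auto simp: facet_of_def)
  then show ?thesis
    using valid unfolding facet_defining_ge_def F_def w by simp
qed

end
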